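(* For every integer $h \ge 2$ there exists a set $A$ of positive integers which is simultaneously an asymptotic basis of order $2h$ and a $B_h[1]$-set.
   Context: For a set $A$ of positive integers and integers $k\ge 1$, $n \ge 0$, let $R_{k,A}(n)$ denote the number of solutions of $a_1 + a_2 + \dots + a_k = n$ with $a_1,\dots,a_k \in A$ and $a_1 \le a_2 \le \dots \le a_k$. A set $A$ is an asymptotic basis of order $k$ if there is $n_0$ such that $R_{k,A}(n) > 0$ for all $n > n_0$. A set $A$ is a $B_h[g]$-set if $R_{h,A}(n) \le g$ for every $n \ge 0$. *)

theory Defs
  imports Main
begin

definition R :: "nat \<Rightarrow> nat set \<Rightarrow> nat \<Rightarrow> nat" where
  "R k A n = card {xs :: nat list. length xs = k \<and> sorted xs \<and> set xs \<subseteq> A \<and> sum_list xs = n}"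

definition asymptotic_basis :: "nat \<Rightarrow> nat set \<Rightarrow> bool" where
  "asymptotic_basis k A \<longleftrightarrow> (\<exists>n0. \<forall>n > n0. R k A n > 0)"

definition B_set :: "nat \<Rightarrow> nat \<Rightarrow> nat set \<Rightarrow> bool" where
  "B_set h g A \<longleftrightarrow> (\<forall>n. R h A n \<le> g)"

end

theory Submission
  imports Complex_Main Defs "HOL-Library.Multiset" "HOL-Library.FuncSet"
begin

text \<open>
  The set grows in stages: stage \<open>k\<close> enlarges a finite set \<open>A\<close> so that all integers of a range of
  order \<open>x\<^bsup>4h-1\<^esup>\<close>, \<open>x = 2\<^sup>k\<close>, become sums of \<open>2h\<close> elements. Add \<open>2h\<close> blocks of \<open>x\<^sup>2\<close> random elements, keeping only
  those that satisfy no relation of \<open>B\<^sub>h\<close> type with \<open>A\<close> and the other random elements, so that the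
  \<open>B\<^sub>h\<close> property survives. For a fixed \<open>n\<close> the number of representations with one
  element from each block is concentrated by Chebyshev's inequality, and few of them in expectation
  contain a discarded element: a relation involves at most \<open>h < 2h\<close> elements on one side, hence is
  linearly independent of the equation defining the representation. So \<open>n\<close> stays uncovered with probability
  \<open>O(1/x)\<close>. This is too weak for a union bound, but nothing was assumed about \<open>A\<close> except its
  size: by averaging, some choice reduces the number of uncovered integers by a factor \<open>O(1/x)\<close>, and
  after \<open>4h\<close> repetitions none is left.
\<close>

section \<open>Strong \<open>B\<^sub>h\<close> sets\<close>

text \<open>Since sizes up to \<open>h\<close> are allowed and need not agree, for positive integers
  this is the B_h property of \<open>insert 0 A\<close>. It is stable under cancelling common terms,
  which shortens both sums.\<close>

definition strong_B :: "nat \<Rightarrow> nat set \<Rightarrow> bool" where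
  "strong_B h A \<longleftrightarrow> (\<forall>P Q. set_mset P \<subseteq> A \<longrightarrow> set_mset Q \<subseteq> A \<longrightarrow> size P \<le> h \<longrightarrow> size Q \<le> h
     \<longrightarrow> sum_mset P = sum_mset Q \<longrightarrow> P = Q)"

definition ksums :: "nat \<Rightarrow> nat set \<Rightarrow> nat set" where
  "ksums k A = {n. \<exists>P. set_mset P \<subseteq> A \<and> size P = k \<and> sum_mset P = n}"

text \<open>Here \<open>c\<close> is the excess multiplicity of \<open>v\<close> in an equation
  between two sums of at most \<open>h\<close> terms. Padding with 0 fixes the lengths;
  \<open>p\<close> gets only \<open>h - 1\<close> entries because at least one term on its side is
  \<open>v\<close> itself.\<close>

definition forbidden :: "nat \<Rightarrow> nat set \<Rightarrow> nat set" where
  "forbidden h B = {v. \<exists>c p q. c \<in> {1..h} \<and> set p \<subseteq> insert 0 B \<and> set q \<subseteq> insert 0 B \<and>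
     length p = h - 1 \<and> length q = h \<and> c * v + sum_list p = sum_list q}"

lemma ksums_mono: "A \<subseteq> B \<Longrightarrow> ksums k A \<subseteq> ksums k B"
  unfolding ksums_def by blast

lemma forbidden_mono: "A \<subseteq> B \<Longrightarrow> forbidden h A \<subseteq> forbidden h B"
  unfolding forbidden_def by (smt (verit) Collect_mono insert_mono subset_trans)

lemma strong_B_empty: "strong_B h {}"
  unfolding strong_B_def by simp

section \<open>Passing between multisets and the counting function \<open>R\<close>\<close>

lemma finite_lists_R: "finite {xs :: nat list. length xs = k \<and> sorted xs \<and> set xs \<subseteq> A \<and> sum_list xs = n}"
proof (rule finite_subset)
  show "finite {xs :: nat list. set xs \<subseteq> {..n} \<and> length xs = k}"
    by (rule finite_lists_length_eq) simp
  show "{xs :: nat list. length xs = k \<and> sorted xs \<and> set xs \<subseteq> A \<and> sum_list xs = n}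
    \<subseteq> {xs. set xs \<subseteq> {..n} \<and> length xs = k}"
    by (auto intro: member_le_sum_list)
qed

lemma strong_B_imp_B_set:
  assumes "strong_B h A"
  shows "B_set h 1 A"
  unfolding B_set_def R_def
proof (intro allI)
  fix n
  have "xs = ys" if "length xs = h" "sorted xs" "set xs \<subseteq> A" "sum_list xs = n"
    "length ys = h" "sorted ys" "set ys \<subseteq> A" "sum_list ys = n" for xs ys :: "nat list"
  proof -
    have "mset xs = mset ys"
      using assms[unfolded strong_B_def, rule_format, of "mset xs" "mset ys"] that
      by (simp add: sum_mset_sum_list)
    with that show ?thesis using properties_for_sort by metis
  qed
  then show "card {xs :: nat list. length xs = h \<and> sorted xs \<and> set xs \<subseteq> A \<and> sum_list xs = n} \<le> 1"
    using finite_lists_R by (subst card_le_Suc0_iff_eq[unfolded One_nat_def[symmetric]]) auto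
qed

lemma ksums_imp_R_pos:
  assumes "n \<in> ksums k A"
  shows "R k A n > 0"
proof -
  obtain P where P: "set_mset P \<subseteq> A" "size P = k" "sum_mset P = n"
    using assms unfolding ksums_def by blast
  let ?xs = "sorted_list_of_multiset P"
  have "mset ?xs = P" by simp
  then have "length ?xs = k" "set ?xs \<subseteq> A" "sum_list ?xs = n"
    using P by (metis size_mset, metis set_mset_mset, metis sum_mset_sum_list)
  moreover have "sorted ?xs" by simp
  ultimately have "?xs \<in> {xs. length xs = k \<and> sorted xs \<and> set xs \<subseteq> A \<and> sum_list xs = n}"
    by blast
  then show ?thesis unfolding R_def using finite_lists_R card_gt_0_iff by blast
qed

lemma pad_list:
  fixes P :: "nat multiset"
  assumes "size P \<le> k"
  obtains p where "length p = k" "set p \<subseteq> insert 0 (set_mset P)" "sum_list p = sum_mset P"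
proof -
  obtain p where p: "mset p = P + replicate_mset (k - size P) 0" using ex_mset by blast
  have "length p = k"
    using arg_cong[OF p, of size] assms by simp
  moreover have "set p \<subseteq> insert 0 (set_mset P)"
    using arg_cong[OF p, of set_mset] by (auto split: if_splits)
  moreover have "sum_list p = sum_mset P"
    using arg_cong[OF p, of sum_mset] by (simp add: sum_mset_sum_list)
  ultimately show ?thesis using that by blast
qed

section \<open>Enlarging strong B_h sets\<close>

lemma sum_mset_split_off:
  fixes P :: "nat multiset"
  shows "sum_mset P = count P v * v + sum_mset {#x \<in># P. x \<noteq> v#}"
    and "size P = count P v + size {#x \<in># P. x \<noteq> v#}"
proof -
  have "P = replicate_mset (count P v) v + {#x \<in># P. x \<noteq> v#}"
    by (metis filter_eq_replicate_mset multiset_partition)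
  then show "sum_mset P = count P v * v + sum_mset {#x \<in># P. x \<noteq> v#}"
    "size P = count P v + size {#x \<in># P. x \<noteq> v#}"
    by (metis sum_mset.union sum_mset_replicate_mset mult.commute of_nat_id,
        metis size_union size_replicate_mset)
qed

text \<open>Cancelling \<open>count Q v\<close> copies of \<open>v\<close> on both sides leaves
  \<open>c\<close> copies beside \<open>P\<close>. The other terms of \<open>P\<close> number at
  most \<open>h - 1\<close>, as \<open>v\<close> occurs in \<open>P\<close>, and padding with 0
  gives the required lists.\<close>

lemma forbidden_if_count_less:
  fixes P Q :: "nat multiset"
  assumes "set_mset P \<subseteq> B" "set_mset Q \<subseteq> B" "size P \<le> h" "size Q \<le> h"
    and "sum_mset P = sum_mset Q" and less: "count Q v < count P v"
  shows "v \<in> forbidden h (B - {v})"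
proof -
  let ?P = "{#x \<in># P. x \<noteq> v#}" and ?Q = "{#x \<in># Q. x \<noteq> v#}"
  have "size ?P \<le> h - 1" "size ?Q \<le> h"
    using sum_mset_split_off(2)[of P v] sum_mset_split_off(2)[of Q v] assms by linarith+
  then obtain p q where p: "length p = h - 1" "set p \<subseteq> insert 0 (set_mset ?P)" "sum_list p = sum_mset ?P"
    and q: "length q = h" "set q \<subseteq> insert 0 (set_mset ?Q)" "sum_list q = sum_mset ?Q"
    by (metis pad_list)
  define c where "c = count P v - count Q v"
  have cP: "count P v = c + count Q v" using less c_def by simp
  have "count P v \<le> h" using sum_mset_split_off(2)[of P v] assms by linarith
  then have "c \<in> {1..h}" using less c_def by auto
  moreover have "c * v + sum_list p = sum_list q"
    using sum_mset_split_off(1)[of P v] sum_mset_split_off(1)[of Q v] assms(5) p q cP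
    by (simp add: algebra_simps)
  moreover have "set p \<subseteq> insert 0 (B - {v})" "set q \<subseteq> insert 0 (B - {v})"
    using p q assms by auto
  ultimately show ?thesis unfolding forbidden_def using p q by blast
qed

text \<open>If two equal sums used some \<open>v\<close> in \<open>G\<close> with different
  multiplicities, isolating \<open>v\<close> would make it forbidden. So the parts in
  \<open>G\<close> agree and cancel, and an equation inside \<open>A\<close> remains.\<close>

lemma strong_B_extend:
  assumes A: "strong_B h A"
    and G: "\<And>v. v \<in> G \<Longrightarrow> v \<notin> forbidden h ((A \<union> G) - {v})"
  shows "strong_B h (A \<union> G)"
  unfolding strong_B_def
proof (intro allI impI)
  fix P Q :: "nat multiset"
  assume P: "set_mset P \<subseteq> A \<union> G" "size P \<le> h" and Q: "set_mset Q \<subseteq> A \<union> G" "size Q \<le> h"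
    and eq: "sum_mset P = sum_mset Q"
  have cnt: "count P v = count Q v" if "v \<in> G" for v
    using forbidden_if_count_less[of P "A \<union> G" Q h v] forbidden_if_count_less[of Q "A \<union> G" P h v]
      G[OF that] P Q eq by (metis linorder_neqE_nat)
  have G_eq: "{#x \<in># P. x \<in> G#} = {#x \<in># Q. x \<in> G#}"
    by (rule multiset_eqI) (simp add: cnt)
  have "sum_mset {#x \<in># P. x \<notin> G#} = sum_mset {#x \<in># Q. x \<notin> G#}"
    using eq G_eq multiset_partition[of P "\<lambda>x. x \<in> G"] multiset_partition[of Q "\<lambda>x. x \<in> G"]
    by (metis add_left_cancel sum_mset.union)
  moreover have "size {#x \<in># P. x \<notin> G#} \<le> h" "size {#x \<in># Q. x \<notin> G#} \<le> h"
    using P Q size_filter_mset_lesseq le_trans by blast+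
  moreover have "set_mset {#x \<in># P. x \<notin> G#} \<subseteq> A" "set_mset {#x \<in># Q. x \<notin> G#} \<subseteq> A"
    using P Q by auto
  ultimately have "{#x \<in># P. x \<notin> G#} = {#x \<in># Q. x \<notin> G#}"
    using A unfolding strong_B_def by blast
  then show "P = Q" using G_eq multiset_partition by metis
qed

text \<open>Two given multisets involve finitely many elements, so a single member of the chain
  contains them all.\<close>

lemma strong_B_Union_chain:
  assumes mono: "\<And>k. S k \<subseteq> S (Suc k)" and S: "\<And>k. strong_B h (S k)"
  shows "strong_B h (\<Union>k. S k)"
  unfolding strong_B_def
proof (intro allI impI)
  fix P Q :: "nat multiset"
  assume "set_mset P \<subseteq> (\<Union>k. S k)" "set_mset Q \<subseteq> (\<Union>k. S k)" and
    h: "size P \<le> h" "size Q \<le> h" "sum_mset P = sum_mset Q"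
  then have sub: "set_mset P \<union> set_mset Q \<subseteq> \<Union> (range S)" by auto
  have "\<exists>B\<in>range S. set_mset P \<union> set_mset Q \<subseteq> B"
  proof (rule finite_subset_Union_chain[OF _ sub])
    show "subset.chain UNIV (range S)"
      unfolding subset_chain_def using lift_Suc_mono_le[of S, OF mono] nat_le_linear by blast
  qed auto
  then show "P = Q" using S h unfolding strong_B_def by (metis Un_subset_iff imageE)
qed

section \<open>Counting in product spaces\<close>

text \<open>Forgetting the coordinates \<open>i\<close> and \<open>j\<close> is injective on
  \<open>E\<close>. In probabilistic terms, two independent constraints cost a factor
  \<open>card (V i) * card (V j)\<close>.\<close>

lemma card_PiE_two_coordinates:
  assumes fin: "finite J" "\<And>j. j \<in> J \<Longrightarrow> finite (V j)" and ij: "i \<in> J" "j \<in> J" "i \<noteq> j"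
    and E: "E \<subseteq> PiE J V"
    and uniq: "\<And>f g. f \<in> E \<Longrightarrow> g \<in> E \<Longrightarrow> (\<And>l. l \<noteq> i \<Longrightarrow> l \<noteq> j \<Longrightarrow> f l = g l) \<Longrightarrow> f i = g i \<and> f j = g j"
  shows "card E * (card (V i) * card (V j)) \<le> card (PiE J V)"
proof -
  let ?J = "J - {i} - {j}"
  have "inj_on (\<lambda>f. restrict f ?J) E"
  proof (rule inj_onI)
    fix f g assume f: "f \<in> E" and g: "g \<in> E" and eq: "restrict f ?J = restrict g ?J"
    have "f l = g l" if "l \<noteq> i" "l \<noteq> j" for l
    proof (cases "l \<in> J")
      case True then show ?thesis using that fun_cong[OF eq, of l] by simp
    next
      case False then show ?thesis using f g E PiE_arb by (metis subsetD)
    qed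
    moreover from this have "f i = g i \<and> f j = g j" using uniq f g by blast
    ultimately show "f = g" by (metis ext)
  qed
  moreover have "(\<lambda>f. restrict f ?J) ` E \<subseteq> PiE ?J V"
  proof
    fix g assume "g \<in> (\<lambda>f. restrict f ?J) ` E"
    then obtain f where f: "f \<in> PiE J V" "g = restrict f ?J" using E by blast
    show "g \<in> PiE ?J V" using f by (auto simp: PiE_iff)
  qed
  ultimately have "card E \<le> card (PiE ?J V)"
    using fin by (intro card_inj_on_le[of _ E "PiE ?J V"]) (auto intro!: finite_PiE)
  also have "card (PiE ?J V) = (\<Prod>l\<in>?J. card (V l))" using fin by (simp add: card_PiE)
  finally have "card E * (card (V i) * card (V j)) \<le> (\<Prod>l\<in>?J. card (V l)) * (card (V i) * card (V j))"
    by (rule mult_right_mono) simp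
  also have "\<dots> = card (PiE J V)"
    using fin ij by (simp add: card_PiE prod.remove[of J i] prod.remove[of "J - {i}" j])
  finally show ?thesis .
qed

text \<open>As \<open>F\<close> ignores coordinate \<open>i\<close>, every choice of the other
  coordinates leaves exactly one favourable value at \<open>i\<close>. Overwriting coordinate
  \<open>i\<close> with an arbitrary element of \<open>V i\<close> gives the bijection.\<close>

lemma card_PiE_one_coordinate:
  assumes fin: "finite J" "\<And>j. j \<in> J \<Longrightarrow> finite (V j)" and i: "i \<in> J"
    and F: "\<And>f. f \<in> PiE J V \<Longrightarrow> F f \<in> V i"
    and F_upd: "\<And>f a. F (f(i := a)) = F f"
  shows "card {f \<in> PiE J V. f i = F f} * card (V i) = card (PiE J V)"
proof -
  let ?E = "{f \<in> PiE J V. f i = F f}"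
  have "bij_betw (\<lambda>(f, a). f(i := a)) (?E \<times> V i) (PiE J V)"
  proof (rule bij_betw_byWitness[where f' = "\<lambda>f. (f(i := F f), f i)"])
    show "\<forall>a\<in>?E \<times> V i. (case case a of (f, a) \<Rightarrow> f(i := a) of f \<Rightarrow> (f(i := F f), f i)) = a"
      by (auto simp: F_upd)
    show "\<forall>f\<in>PiE J V. (case (f(i := F f), f i) of (f, a) \<Rightarrow> f(i := a)) = f" by simp
    show "(\<lambda>(f, a). f(i := a)) ` (?E \<times> V i) \<subseteq> PiE J V" using i by (auto simp: PiE_iff extensional_def)
    show "(\<lambda>f. (f(i := F f), f i)) ` PiE J V \<subseteq> ?E \<times> V i"
    proof
      fix y assume "y \<in> (\<lambda>f. (f(i := F f), f i)) ` PiE J V"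
      then obtain f where f: "f \<in> PiE J V" "y = (f(i := F f), f i)" by blast
      have "f(i := F f) \<in> PiE J V" using f(1) F[OF f(1)] i by (auto simp: PiE_iff extensional_def)
      then show "y \<in> ?E \<times> V i" using f i by (auto simp: F_upd)
    qed
  qed
  then have "card (?E \<times> V i) = card (PiE J V)" by (rule bij_betw_same_card)
  then show ?thesis by (simp add: card_cartesian_product)
qed

section \<open>Random families\<close>

text \<open>There are \<open>2 * h\<close> blocks of \<open>m\<close> random elements, to be added
  to the set \<open>A\<close> built so far; \<open>r\<close> bounds the values in block 0 and
  \<open>W\<close> those in the other blocks.\<close>

locale random_family =
  fixes h m W r :: nat and A :: "nat set"
  assumes h_pos: "h \<ge> 1" and m_pos: "m \<ge> 1" and W_pos: "W \<ge> 1" and W_le: "W \<le> r"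
    and finite_A: "finite A"
begin

section \<open>The sample space and the hits of an integer\<close>

definition J :: "(nat \<times> nat) set" where "J = {..<2 * h} \<times> {..<m}"

text \<open>Block 0 is wide so that it can complete every choice in the other blocks to any
  \<open>n\<close> in \<open>{2 * h * W<..r}\<close>.\<close>

definition V :: "nat \<times> nat \<Rightarrow> nat set" where "V i = (if fst i = 0 then {1..r} else {1..W})"

definition \<Omega> :: "(nat \<times> nat \<Rightarrow> nat) set" where "\<Omega> = PiE J V"

definition T :: "(nat \<Rightarrow> nat) set" where "T = PiE {..<2 * h} (\<lambda>_. {..<m})"

definition tsum :: "(nat \<times> nat \<Rightarrow> nat) \<Rightarrow> (nat \<Rightarrow> nat) \<Rightarrow> nat" where
  "tsum \<omega> t = (\<Sum>j<2 * h. \<omega> (j, t j))"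

definition hits :: "nat \<Rightarrow> (nat \<times> nat \<Rightarrow> nat) \<Rightarrow> (nat \<Rightarrow> nat) set" where
  "hits n \<omega> = {t \<in> T. tsum \<omega> t = n}"

text \<open>The position \<open>i\<close> is removed, not its value. Hence a value that occurs at
  two positions or already lies in \<open>A\<close> is forbidden (take \<open>c = 1\<close>) and is
  discarded.\<close>

definition good :: "(nat \<times> nat \<Rightarrow> nat) \<Rightarrow> nat set" where
  "good \<omega> = {\<omega> i | i. i \<in> J \<and> \<omega> i \<notin> forbidden h (A \<union> \<omega> ` (J - {i}))}"

definition \<mu> :: real where "\<mu> = real m ^ (2 * h) / real r"

lemma r_pos: "r \<ge> 1" using W_pos W_le by simp

lemma \<mu>_pos: "\<mu> > 0" using m_pos r_pos unfolding \<mu>_def by simp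

lemma finite_J: "finite J" unfolding J_def by simp

lemma finite_V: "finite (V i)" unfolding V_def by simp

lemma card_V: "card (V i) = (if fst i = 0 then r else W)" unfolding V_def by simp

lemma W_le_card_V: "W \<le> card (V i)" using W_le by (simp add: card_V)

lemma finite_\<Omega>: "finite \<Omega>"
  unfolding \<Omega>_def by (rule finite_PiE) (auto simp: finite_J finite_V)

lemma card_\<Omega>_pos: "card \<Omega> > 0"
  unfolding \<Omega>_def using W_pos W_le_card_V finite_J
  by (simp add: card_PiE) (metis One_nat_def le_trans not_less_eq_eq bot_nat_0.extremum gr0I prod_pos)

lemma finite_T: "finite T" unfolding T_def by (rule finite_PiE) auto

lemma card_T: "card T = m ^ (2 * h)" unfolding T_def by (simp add: card_PiE)

lemma T_in_J: "t \<in> T \<Longrightarrow> j < 2 * h \<Longrightarrow> (j, t j) \<in> J"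
  unfolding T_def J_def by (auto simp: PiE_iff)

lemma zero_less_2h: "0 < 2 * h" using h_pos by simp

lemma \<Omega>_in_V: "\<omega> \<in> \<Omega> \<Longrightarrow> i \<in> J \<Longrightarrow> \<omega> i \<in> V i"
  unfolding \<Omega>_def by (auto simp: PiE_iff)

lemma card_two_coordinates:
  assumes "i \<in> J" "j \<in> J" "i \<noteq> j" "E \<subseteq> \<Omega>"
    and "\<And>f g. f \<in> E \<Longrightarrow> g \<in> E \<Longrightarrow> (\<And>l. l \<noteq> i \<Longrightarrow> l \<noteq> j \<Longrightarrow> f l = g l) \<Longrightarrow> f i = g i \<and> f j = g j"
  shows "real (card E) \<le> real (card \<Omega>) / (real (card (V i)) * real (card (V j)))"
proof -
  have "card E * (card (V i) * card (V j)) \<le> card \<Omega>"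
    using assms unfolding \<Omega>_def
    by (intro card_PiE_two_coordinates) (auto simp: finite_J finite_V)
  moreover have "card (V i) * card (V j) > 0" using W_le_card_V W_pos
    by (metis One_nat_def Suc_le_lessD le_trans nat_0_less_mult_iff)
  ultimately show ?thesis
    by (simp add: pos_le_divide_eq flip: of_nat_mult)
qed

lemma tsum_split: "j < 2 * h \<Longrightarrow> tsum \<omega> t = \<omega> (j, t j) + (\<Sum>l\<in>{..<2 * h} - {j}. \<omega> (l, t l))"
  unfolding tsum_def by (simp add: sum.remove)

lemma tsum_tail_le:
  assumes "\<omega> \<in> \<Omega>" "t \<in> T"
  shows "(\<Sum>l\<in>{..<2 * h} - {0}. \<omega> (l, t l)) \<le> (2 * h - 1) * W"
proof -
  have "\<omega> (l, t l) \<le> W" if "l \<in> {..<2 * h} - {0}" for l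
    using \<Omega>_in_V[OF assms(1) T_in_J[OF assms(2), of l]] that unfolding V_def by simp
  moreover have "card ({..<2 * h} - {0}) = 2 * h - 1"
    using zero_less_2h by (subst card_Diff_singleton) auto
  ultimately show ?thesis
    using sum_bounded_above[of "{..<2 * h} - {0}" "\<lambda>l. \<omega> (l, t l)" W] by simp
qed

text \<open>The blocks other than 0 sum to at most \<open>(2 * h - 1) * W < n\<close>, so exactly
  one value in \<open>{1..r}\<close> at position \<open>(0, t 0)\<close> completes the sum to
  \<open>n\<close>.\<close>

lemma card_hit:
  assumes t: "t \<in> T" and n: "n \<in> {2 * h * W<..r}"
  shows "real (card {\<omega> \<in> \<Omega>. tsum \<omega> t = n}) = real (card \<Omega>) / real r"
proof -
  let ?i = "(0::nat, t 0)"
  define F where "F = (\<lambda>\<omega>::nat \<times> nat \<Rightarrow> nat. n - (\<Sum>l\<in>{..<2 * h} - {0}. \<omega> (l, t l)))"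
  have le: "(\<Sum>l\<in>{..<2 * h} - {0}. \<omega> (l, t l)) < n" if "\<omega> \<in> \<Omega>" for \<omega>
  proof -
    have "(2 * h - 1) * W \<le> 2 * h * W" by (rule mult_right_mono) simp_all
    then show ?thesis using tsum_tail_le[OF that t] n by (simp only: greaterThanAtMost_iff) linarith
  qed
  have "card {\<omega> \<in> PiE J V. \<omega> ?i = F \<omega>} * card (V ?i) = card (PiE J V)"
  proof (rule card_PiE_one_coordinate)
    fix \<omega> assume "\<omega> \<in> PiE J V"
    then have "\<omega> \<in> \<Omega>" by (simp add: \<Omega>_def)
    then show "F \<omega> \<in> V ?i" using le[of \<omega>] n unfolding F_def V_def by auto
  next
    fix \<omega> a show "F (\<omega>(?i := a)) = F \<omega>" unfolding F_def by (auto intro!: sum.cong)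
  qed (auto simp: finite_J finite_V T_in_J[OF t zero_less_2h])
  moreover have "{\<omega> \<in> PiE J V. \<omega> ?i = F \<omega>} = {\<omega> \<in> \<Omega>. tsum \<omega> t = n}"
    unfolding \<Omega>_def[symmetric] F_def using tsum_split[OF zero_less_2h, of _ t] le by fastforce
  ultimately show ?thesis using r_pos unfolding \<Omega>_def[symmetric] by (simp add: card_V field_simps flip: of_nat_mult)
qed

text \<open>The two equations are triangular: the sum over \<open>t'\<close> avoids position
  \<open>(j, t j)\<close> and determines the value at \<open>(0, t' 0)\<close>; then the sum over
  \<open>t\<close> determines the value at \<open>(j, t j)\<close>.\<close>

lemma card_double_hit:
  assumes t: "t \<in> T" "t' \<in> T" and j: "j < 2 * h" "t j \<noteq> t' j"
  shows "real (card {\<omega> \<in> \<Omega>. tsum \<omega> t = n \<and> tsum \<omega> t' = n})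
    \<le> real (card \<Omega>) / (real (card (V (j, t j))) * real r)"
proof -
  let ?i = "(j, t j)" and ?i' = "(0::nat, t' 0)"
  let ?E = "{\<omega> \<in> \<Omega>. tsum \<omega> t = n \<and> tsum \<omega> t' = n}"
  have "real (card ?E) \<le> real (card \<Omega>) / (real (card (V ?i)) * real (card (V ?i')))"
  proof (rule card_two_coordinates)
    fix f g assume f: "f \<in> ?E" and g: "g \<in> ?E" and eq: "\<And>l. l \<noteq> ?i \<Longrightarrow> l \<noteq> ?i' \<Longrightarrow> f l = g l"
    have "(\<Sum>l\<in>{..<2 * h} - {0}. f (l, t' l)) = (\<Sum>l\<in>{..<2 * h} - {0}. g (l, t' l))"
      using j by (intro sum.cong refl eq) auto
    then have i': "f ?i' = g ?i'"
      using f g tsum_split[OF zero_less_2h, of f t'] tsum_split[OF zero_less_2h, of g t'] by simp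
    then have "(\<Sum>l\<in>{..<2 * h} - {j}. f (l, t l)) = (\<Sum>l\<in>{..<2 * h} - {j}. g (l, t l))"
      using eq by (intro sum.cong refl) (metis DiffE insertCI prod.inject)
    then have "f ?i = g ?i"
      using f g tsum_split[OF j(1), of f t] tsum_split[OF j(1), of g t] by simp
    with i' show "f ?i = g ?i \<and> f ?i' = g ?i'" by blast
  qed (use t j T_in_J zero_less_2h in auto)
  then show ?thesis by (simp add: card_V)
qed

section \<open>Mean and variance of the number of hits\<close>

lemma sum_card_hits:
  assumes "n \<in> {2 * h * W<..r}"
  shows "(\<Sum>\<omega>\<in>\<Omega>. real (card (hits n \<omega>))) = \<mu> * real (card \<Omega>)"
proof -
  have "(\<Sum>\<omega>\<in>\<Omega>. real (card (hits n \<omega>))) = (\<Sum>\<omega>\<in>\<Omega>. \<Sum>t\<in>T. of_bool (tsum \<omega> t = n))"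
    unfolding hits_def by (intro sum.cong refl) (simp add: finite_T Int_def)
  also have "\<dots> = (\<Sum>t\<in>T. \<Sum>\<omega>\<in>\<Omega>. of_bool (tsum \<omega> t = n))" by (rule sum.swap)
  also have "\<dots> = (\<Sum>t\<in>T. real (card {\<omega> \<in> \<Omega>. tsum \<omega> t = n}))"
    by (intro sum.cong refl) (simp add: finite_\<Omega> Int_def)
  also have "\<dots> = \<mu> * real (card \<Omega>)"
    using card_hit assms by (simp add: card_T \<mu>_def)
  finally show ?thesis .
qed

lemma card_T_fix_zero:
  assumes "t \<in> T"
  shows "card {t' \<in> T. t' 0 = t 0} \<le> m ^ (2 * h - 1)"
proof -
  have "card {t' \<in> T. t' 0 = t 0} \<le> card (PiE ({..<2 * h} - {0}) (\<lambda>_. {..<m}))"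
  proof (rule card_inj_on_le[where f = "\<lambda>t'. restrict t' ({..<2 * h} - {0})"])
    show "inj_on (\<lambda>t'. restrict t' ({..<2 * h} - {0})) {t' \<in> T. t' 0 = t 0}"
    proof (rule inj_onI)
      fix a b assume a: "a \<in> {t' \<in> T. t' 0 = t 0}" and b: "b \<in> {t' \<in> T. t' 0 = t 0}"
        and eq: "restrict a ({..<2 * h} - {0}) = restrict b ({..<2 * h} - {0})"
      show "a = b"
      proof (rule PiE_ext[of a "{..<2 * h}" "\<lambda>_. {..<m}" b])
        fix l assume "l \<in> {..<2 * h}"
        then show "a l = b l" using a b fun_cong[OF eq, of l] by (cases "l = 0") auto
      qed (use a b T_def in auto)
    qed
    show "(\<lambda>t'. restrict t' ({..<2 * h} - {0})) ` {t' \<in> T. t' 0 = t 0}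
      \<subseteq> PiE ({..<2 * h} - {0}) (\<lambda>_. {..<m})"
      unfolding T_def by (auto simp: PiE_iff extensional_def split: if_splits)
  qed (auto intro: finite_PiE)
  then show ?thesis using zero_less_2h by (simp add: card_PiE)
qed

text \<open>Expand the square into pairs of tuples. The diagonal gives \<mu>, and pairs that differ
  in block 0 are at most as likely as independent ones and give at most
  \<open>\<mu>\<^sup>2\<close>. Pairs that agree in block 0 but differ elsewhere have probability at
  most \<open>1 / (r * W)\<close>, and there are at most \<open>m ^ (4 * h - 1)\<close> of
  them.\<close>

lemma sum_card_hits_sq:
  assumes n: "n \<in> {2 * h * W<..r}"
  shows "(\<Sum>\<omega>\<in>\<Omega>. (real (card (hits n \<omega>)))\<^sup>2)
    \<le> real (card \<Omega>) * (\<mu> + \<mu>\<^sup>2 + real m ^ (4 * h - 1) / (real r * real W))"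
proof -
  define N where "N = real (card \<Omega>)"
  have N0: "N \<ge> 0" unfolding N_def by simp
  let ?p = "\<lambda>t t'. real (card {\<omega> \<in> \<Omega>. tsum \<omega> t = n \<and> tsum \<omega> t' = n})"
  have "(\<Sum>\<omega>\<in>\<Omega>. (real (card (hits n \<omega>)))\<^sup>2)
    = (\<Sum>\<omega>\<in>\<Omega>. \<Sum>t\<in>T. \<Sum>t'\<in>T. of_bool (tsum \<omega> t = n \<and> tsum \<omega> t' = n))"
  proof (intro sum.cong refl)
    fix \<omega>
    have c: "real (card (hits n \<omega>)) = (\<Sum>t\<in>T. of_bool (tsum \<omega> t = n))"
      unfolding hits_def by (simp add: finite_T Int_def)
    show "(real (card (hits n \<omega>)))\<^sup>2
      = (\<Sum>t\<in>T. \<Sum>t'\<in>T. of_bool (tsum \<omega> t = n \<and> tsum \<omega> t' = n))"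
      unfolding c power2_eq_square sum_product by (simp only: of_bool_conj)
  qed
  also have "\<dots> = (\<Sum>t\<in>T. \<Sum>\<omega>\<in>\<Omega>. \<Sum>t'\<in>T. of_bool (tsum \<omega> t = n \<and> tsum \<omega> t' = n))"
    by (rule sum.swap)
  also have "\<dots> = (\<Sum>t\<in>T. \<Sum>t'\<in>T. \<Sum>\<omega>\<in>\<Omega>. of_bool (tsum \<omega> t = n \<and> tsum \<omega> t' = n))"
    by (intro sum.cong refl) (rule sum.swap)
  also have "\<dots> = (\<Sum>t\<in>T. \<Sum>t'\<in>T. ?p t t')"
    by (intro sum.cong refl) (simp add: finite_\<Omega> Int_def)
  also have "\<dots> \<le> (\<Sum>t\<in>T. N / r + real m ^ (2 * h) * (N / (real r * real r))
      + real m ^ (2 * h - 1) * (N / (real r * real W)))"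
  proof (rule sum_mono)
    fix t assume t: "t \<in> T"
    have p: "?p t t' \<le> (if t' = t then N / r else 0) + N / (real r * real r)
        + (if t' 0 = t 0 then N / (real r * real W) else 0)" if t': "t' \<in> T" for t'
    proof -
      have nn: "0 \<le> N / r" "0 \<le> N / (real r * real r)" "0 \<le> N / (real r * real W)"
        using N0 by auto
      consider "t' = t" | "t' 0 \<noteq> t 0" | "t' \<noteq> t" "t' 0 = t 0" by blast
      then show ?thesis
      proof cases
        case 1
        then have "?p t t' = N / r" using card_hit[OF t n] N_def by simp
        with 1 nn show ?thesis by simp
      next
        case 2
        then have "?p t t' \<le> N / (real r * real r)"
          using card_double_hit[OF t t' zero_less_2h, of n] by (simp add: card_V N_def)
        with 2 nn show ?thesis by auto
      next
        case 3
        then obtain j where j: "j < 2 * h" "t j \<noteq> t' j"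
          using t t' unfolding T_def by (metis PiE_ext lessThan_iff)
        then have "j \<noteq> 0" using 3 by metis
        then have "?p t t' \<le> N / (real r * real W)"
          using card_double_hit[OF t t' j, of n] by (simp add: card_V N_def mult.commute)
        with 3 nn show ?thesis by simp
      qed
    qed
    have "(\<Sum>t'\<in>T. ?p t t') \<le> (\<Sum>t'\<in>T. (if t' = t then N / r else 0) + N / (real r * real r)
        + (if t' 0 = t 0 then N / (real r * real W) else 0))"
      by (intro sum_mono p)
    also have "\<dots> = N / r + real m ^ (2 * h) * (N / (real r * real r))
        + real (card {t' \<in> T. t' 0 = t 0}) * (N / (real r * real W))"
      using t finite_T by (simp only: sum.distrib card_T sum.delta sum_constant of_nat_power if_True)
         (simp add: sum.If_cases Int_def)
    also have "\<dots> \<le> N / r + real m ^ (2 * h) * (N / (real r * real r))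
        + real m ^ (2 * h - 1) * (N / (real r * real W))"
    proof -
      have "real (card {t' \<in> T. t' 0 = t 0}) \<le> real m ^ (2 * h - 1)"
        using of_nat_mono[OF card_T_fix_zero[OF t], where 'a = real] by simp
      then have "real (card {t' \<in> T. t' 0 = t 0}) * (N / (real r * real W))
        \<le> real m ^ (2 * h - 1) * (N / (real r * real W))"
        by (rule mult_right_mono) (use N0 in simp)
      then show ?thesis by simp
    qed
    finally show "(\<Sum>t'\<in>T. ?p t t') \<le> \<dots>" .
  qed
  also have "\<dots> = real m ^ (2 * h) * (N / r + real m ^ (2 * h) * (N / (real r * real r))
      + real m ^ (2 * h - 1) * (N / (real r * real W)))"
    by (simp add: card_T)
  also have "\<dots> = N * (\<mu> + \<mu>\<^sup>2 + real m ^ (4 * h - 1) / (real r * real W))"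
  proof -
    have "real m ^ (4 * h - 1) = real m ^ (2 * h) * real m ^ (2 * h - 1)"
      using h_pos by (simp flip: power_add)
    then show ?thesis unfolding \<mu>_def by (simp add: power2_eq_square algebra_simps)
  qed
  finally show ?thesis unfolding N_def .
qed

text \<open>In the variance, the square of the mean cancels the term \<open>\<mu>\<^sup>2\<close> of
  the second moment.\<close>

lemma sum_deviation:
  assumes n: "n \<in> {2 * h * W<..r}"
  shows "(\<Sum>\<omega>\<in>\<Omega>. (real (card (hits n \<omega>)) - \<mu>)\<^sup>2)
    \<le> real (card \<Omega>) * (\<mu> + real m ^ (4 * h - 1) / (real r * real W))"
proof -
  have "(\<Sum>\<omega>\<in>\<Omega>. (real (card (hits n \<omega>)) - \<mu>)\<^sup>2)
    = (\<Sum>\<omega>\<in>\<Omega>. (real (card (hits n \<omega>)))\<^sup>2) - 2 * \<mu> * (\<Sum>\<omega>\<in>\<Omega>. real (card (hits n \<omega>)))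
      + \<mu>\<^sup>2 * real (card \<Omega>)"
    by (simp add: power2_diff sum.distrib sum_subtractf sum_distrib_left mult.assoc mult.left_commute mult.commute)
  also have "\<dots> \<le> real (card \<Omega>) * (\<mu> + real m ^ (4 * h - 1) / (real r * real W))"
    using sum_card_hits_sq[OF n] sum_card_hits[OF n]
    by (simp add: power2_eq_square algebra_simps)
  finally show ?thesis .
qed

text \<open>The relation \<open>c v + \<Sum>p = \<Sum>q\<close> witnessing \<open>v \<in> forbidden\<close> is recorded by the positions of its
  terms: \<open>Inl a\<close> stands for the constant \<open>a\<close>, \<open>Inr i\<close> for the random element at position \<open>i\<close>.\<close>

definition symbols :: "(nat + nat \<times> nat) set" where "symbols = Inl ` insert 0 A \<union> Inr ` J"

definition sym_val :: "(nat \<times> nat \<Rightarrow> nat) \<Rightarrow> nat + nat \<times> nat \<Rightarrow> nat" where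
  "sym_val \<omega> = case_sum id \<omega>"

definition relations ::
  "((nat \<Rightarrow> nat) \<times> nat \<times> nat \<times> (nat + nat \<times> nat) list \<times> (nat + nat \<times> nat) list) set" where
  "relations = T \<times> {..<2 * h} \<times> {1..h} \<times> {p. set p \<subseteq> symbols \<and> length p = h - 1}
     \<times> {q. set q \<subseteq> symbols \<and> length q = h}"

definition bad_event where
  "bad_event n = (\<lambda>(t, j, c, p, q). {\<omega> \<in> \<Omega>. tsum \<omega> t = n \<and> Inr (j, t j) \<notin> set p \<and> Inr (j, t j) \<notin> set q \<and>
     c * \<omega> (j, t j) + sum_list (map (sym_val \<omega>) p) = sum_list (map (sym_val \<omega>) q)})"

section \<open>Counting relations and bounding the bad events\<close>

lemma finite_symbols: "finite symbols"
  unfolding symbols_def using finite_A finite_J by simp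

lemma card_symbols: "card symbols \<le> card A + 1 + 2 * h * m"
proof -
  have "card symbols \<le> card (Inl ` insert 0 A :: (nat + nat \<times> nat) set) + card (Inr ` J :: (nat + nat \<times> nat) set)"
    unfolding symbols_def by (rule card_Un_le)
  also have "\<dots> \<le> card (insert 0 A) + card J"
    using finite_A finite_J by (intro add_mono card_image_le) auto
  also have "\<dots> \<le> card A + 1 + 2 * h * m"
    using card_insert_le_m1[of "card A + 1" A 0] by (simp add: J_def card_cartesian_product)
  finally show ?thesis .
qed

lemma finite_relations: "finite relations"
  unfolding relations_def
  by (intro finite_cartesian_product finite_T finite_lists_length_eq finite_symbols) auto

lemma card_relations: "card relations \<le> m ^ (2 * h) * (2 * h\<^sup>2 * (card A + 1 + 2 * h * m) ^ (2 * h - 1))"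
proof -
  have "card relations = m ^ (2 * h) * (2 * h * (h * (card symbols ^ (h - 1) * card symbols ^ h)))"
    unfolding relations_def
    by (simp add: card_cartesian_product card_T card_lists_length_eq finite_symbols)
  also have "card symbols ^ (h - 1) * card symbols ^ h = card symbols ^ (2 * h - 1)"
    using h_pos by (simp add: mult_2 flip: power_add)
  also have "\<dots> \<le> (card A + 1 + 2 * h * m) ^ (2 * h - 1)"
    by (rule power_mono[OF card_symbols]) simp
  finally show ?thesis by (simp add: power2_eq_square mult.assoc)
qed

text \<open>At most \<open>h < 2 h\<close> positions of the tuple \<open>t\<close> occur on the left-hand side of the relation. Take a position
  \<open>i'\<close> that does not. Raising the value at \<open>i\<close> raises the left-hand side strictly, while, the sum over \<open>t\<close> being
  fixed, it lowers the value at \<open>i'\<close> and hence does not raise the right-hand side.\<close>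

lemma card_bad_event:
  assumes "e \<in> relations"
  shows "real (card (bad_event n e)) \<le> real (card \<Omega>) / (real W)\<^sup>2"
proof -
  obtain t j c p q where e: "e = (t, j, c, p, q)" by (cases e) auto
  have t: "t \<in> T" and j: "j < 2 * h" and c: "c \<ge> 1" and lp: "length p = h - 1"
    using assms unfolding e relations_def by auto
  \<comment> \<open>The blocks that meet \<open>p\<close>, together with block \<open>j\<close>,
    number at most \<open>h\<close>. The unspecified value of \<open>projr\<close> on
    \<open>Inl\<close> symbols is harmless: it can only exclude further blocks, and the bound counts
    list entries.\<close>
  have "card ({j} \<union> (\<lambda>s. fst (projr s)) ` set p) \<le> 1 + card ((\<lambda>s. fst (projr s)) ` set p)"
    using card_Un_le[of "{j}"] by simp
  also have "\<dots> \<le> 1 + card (set p)" by (simp add: card_image_le)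
  also have "\<dots> \<le> h" using card_length[of p] lp h_pos by simp
  finally have "card ({j} \<union> (\<lambda>s. fst (projr s)) ` set p) < card {..<2 * h}" using h_pos by simp
  then obtain j' where j': "j' < 2 * h" "j' \<noteq> j" "j' \<notin> (\<lambda>s. fst (projr s)) ` set p"
    by (metis (no_types, lifting) Un_iff card_mono finite.emptyI finite_Un finite_imageI finite_insert
        finite_set insertI1 leD lessThan_iff subsetI)
  let ?i = "(j, t j)" and ?i' = "(j', t j')"
  have notin: "Inr ?i' \<notin> set p" using j'(3) by (metis fst_conv image_eqI sum.sel(2))
  let ?E = "bad_event n e"
  have le: "f ?i \<ge> g ?i" if f: "f \<in> ?E" and g: "g \<in> ?E"
    and eq: "\<And>l. l \<noteq> ?i \<Longrightarrow> l \<noteq> ?i' \<Longrightarrow> f l = g l" and le': "f ?i' \<ge> g ?i'" for f g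
  proof -
    have f': "Inr ?i \<notin> set p" "Inr ?i \<notin> set q"
        "c * f ?i + sum_list (map (sym_val f) p) = sum_list (map (sym_val f) q)"
      and g': "c * g ?i + sum_list (map (sym_val g) p) = sum_list (map (sym_val g) q)"
      using f g unfolding e bad_event_def by auto
    have "map (sym_val f) p = map (sym_val g) p"
      using notin f'(1) eq unfolding sym_val_def by (auto split: sum.splits) metis
    then have "sum_list (map (sym_val f) p) = sum_list (map (sym_val g) p)" by (rule arg_cong)
    moreover have "sum_list (map (sym_val g) q) \<le> sum_list (map (sym_val f) q)"
    proof (rule sum_list_mono)
      fix s assume s: "s \<in> set q"
      show "sym_val g s \<le> sym_val f s"
      proof (cases s)
        case (Inr l)
        then have "l \<noteq> ?i" using s f'(2) by blast
        then show ?thesis using Inr eq[of l] le' unfolding sym_val_def by (cases "l = ?i'") auto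
      qed (simp add: sym_val_def)
    qed
    ultimately have "c * g ?i \<le> c * f ?i" using f'(3) g' by linarith
    then show ?thesis using c by simp
  qed
  have tsum2: "f ?i + f ?i' = g ?i + g ?i'" if f: "f \<in> ?E" and g: "g \<in> ?E"
    and eq: "\<And>l. l \<noteq> ?i \<Longrightarrow> l \<noteq> ?i' \<Longrightarrow> f l = g l" for f g
  proof -
    have split: "tsum w t = w ?i + (w ?i' + (\<Sum>l\<in>{..<2 * h} - {j} - {j'}. w (l, t l)))" for w
      using tsum_split[OF j, of w t] j' by (simp add: sum.remove[of "{..<2 * h} - {j}" j'])
    have "(\<Sum>l\<in>{..<2 * h} - {j} - {j'}. f (l, t l)) = (\<Sum>l\<in>{..<2 * h} - {j} - {j'}. g (l, t l))"
      by (intro sum.cong refl eq) auto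
    moreover have "tsum f t = n" "tsum g t = n" using f g unfolding e bad_event_def by auto
    ultimately show ?thesis using split[of f] split[of g] by simp
  qed
  have "real (card ?E) \<le> real (card \<Omega>) / (real (card (V ?i)) * real (card (V ?i')))"
  proof (rule card_two_coordinates)
    fix f g assume f: "f \<in> ?E" and g: "g \<in> ?E" and eq: "\<And>l. l \<noteq> ?i \<Longrightarrow> l \<noteq> ?i' \<Longrightarrow> f l = g l"
    have eq': "\<And>l. l \<noteq> ?i \<Longrightarrow> l \<noteq> ?i' \<Longrightarrow> g l = f l" using eq by simp
    show "f ?i = g ?i \<and> f ?i' = g ?i'"
      using le[OF f g eq] le[OF g f eq'] tsum2[OF f g eq] by linarith
  qed (use T_in_J[OF t] j j' in \<open>auto simp: e bad_event_def\<close>)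
  also have "\<dots> \<le> real (card \<Omega>) / (real W)\<^sup>2"
    using W_le_card_V W_pos unfolding power2_eq_square
    by (intro divide_left_mono mult_mono mult_pos_pos) (auto intro: Suc_le_lessD le_trans)
  finally show ?thesis .
qed

text \<open>Each value allowed in \<open>p\<close> or \<open>q\<close> is the value of some symbol
  other than \<open>Inr (j, t j)\<close>, so both lists lift entry by entry from values to
  positions.\<close>

lemma forbidden_imp_relation:
  assumes \<omega>: "\<omega> \<in> \<Omega>" and t: "t \<in> hits n \<omega>" and j: "j < 2 * h"
    and forb: "\<omega> (j, t j) \<in> forbidden h (A \<union> \<omega> ` (J - {(j, t j)}))"
  obtains e where "e \<in> relations" "\<omega> \<in> bad_event n e" "fst e = t"
proof -
  let ?i = "(j, t j)" and ?S = "symbols - {Inr (j, t j)}"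
  have sub: "insert 0 (A \<union> \<omega> ` (J - {?i})) \<subseteq> sym_val \<omega> ` ?S"
  proof
    fix v assume v: "v \<in> insert 0 (A \<union> \<omega> ` (J - {?i}))"
    show "v \<in> sym_val \<omega> ` ?S"
    proof (cases "v \<in> insert 0 A")
      case True
      then have "Inl v \<in> ?S" unfolding symbols_def by auto
      then show ?thesis by (metis sym_val_def image_eqI old.sum.simps(5) id_apply)
    next
      case False
      then obtain l where l: "l \<in> J - {?i}" "v = \<omega> l" using v by auto
      then have "Inr l \<in> ?S" unfolding symbols_def by auto
      then show ?thesis using l by (metis sym_val_def image_eqI old.sum.simps(6))
    qed
  qed
  have lift: "\<exists>p'. map (sym_val \<omega>) p' = p \<and> set p' \<subseteq> ?S" if "set p \<subseteq> insert 0 (A \<union> \<omega> ` (J - {?i}))" for p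
  proof -
    have "set p \<subseteq> sym_val \<omega> ` ?S" using that sub by (rule order_trans)
    then have "p \<in> lists (sym_val \<omega> ` ?S)" unfolding lists_eq_set mem_Collect_eq .
    then show ?thesis unfolding lists_image by (auto simp: lists_eq_set)
  qed
  from forb obtain c p q where c: "c \<in> {1..h}" and p: "set p \<subseteq> insert 0 (A \<union> \<omega> ` (J - {?i}))"
    and q: "set q \<subseteq> insert 0 (A \<union> \<omega> ` (J - {?i}))" and len: "length p = h - 1" "length q = h"
    and eq: "c * \<omega> ?i + sum_list p = sum_list q"
    unfolding forbidden_def by blast
  from lift[OF p] obtain p' where p': "map (sym_val \<omega>) p' = p" "set p' \<subseteq> ?S" by blast
  from lift[OF q] obtain q' where q': "map (sym_val \<omega>) q' = q" "set q' \<subseteq> ?S" by blast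
  have len': "length p' = h - 1" "length q' = h" using len p'(1) q'(1) by auto
  have "(t, j, c, p', q') \<in> relations"
    using c p' q' len' t j unfolding relations_def hits_def by auto
  moreover have "\<omega> \<in> bad_event n (t, j, c, p', q')"
    using p' q' eq \<omega> t unfolding bad_event_def hits_def by auto
  ultimately show ?thesis using that by force
qed

text \<open>If \<open>n\<close> is uncovered, every hit contains a discarded element and is
  therefore the first component of a relation whose bad event occurs. Recording \<open>t\<close> in
  the relation is what makes different hits give different relations.\<close>

lemma card_hits_le_bad:
  assumes \<omega>: "\<omega> \<in> \<Omega>" and n: "n \<notin> ksums (2 * h) (A \<union> good \<omega>)"
  shows "card (hits n \<omega>) \<le> card {e \<in> relations. \<omega> \<in> bad_event n e}"
proof -
  have "hits n \<omega> \<subseteq> fst ` {e \<in> relations. \<omega> \<in> bad_event n e}"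
  proof
    fix t assume t: "t \<in> hits n \<omega>"
    then have tT: "t \<in> T" "tsum \<omega> t = n" unfolding hits_def by auto
    have "\<exists>j<2 * h. \<omega> (j, t j) \<notin> good \<omega>"
    proof (rule ccontr)
      assume *: "\<not> (\<exists>j<2 * h. \<omega> (j, t j) \<notin> good \<omega>)"
      let ?P = "mset (map (\<lambda>j. \<omega> (j, t j)) [0..<2 * h])"
      have "set_mset ?P \<subseteq> A \<union> good \<omega>" using * by auto
      moreover have "sum_mset ?P = n"
        using tT(2) unfolding tsum_def sum_mset_sum_list
        by (simp add: interv_sum_list_conv_sum_set_nat atLeast0LessThan)
      moreover have "size ?P = 2 * h" by simp
      ultimately show False using n unfolding ksums_def by blast
    qed
    then obtain j where j: "j < 2 * h" "\<omega> (j, t j) \<notin> good \<omega>" by blast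
    then have "\<omega> (j, t j) \<in> forbidden h (A \<union> \<omega> ` (J - {(j, t j)}))"
      using T_in_J[OF tT(1) j(1)] unfolding good_def by blast
    then obtain e where "e \<in> relations" "\<omega> \<in> bad_event n e" "fst e = t"
      using forbidden_imp_relation[OF \<omega> t j(1)] by blast
    then show "t \<in> fst ` {e \<in> relations. \<omega> \<in> bad_event n e}" by force
  qed
  moreover have fin: "finite {e \<in> relations. \<omega> \<in> bad_event n e}" using finite_relations by simp
  ultimately show ?thesis using surj_card_le by blast
qed

lemma sum_card_bad:
  "(\<Sum>\<omega>\<in>\<Omega>. real (card {e \<in> relations. \<omega> \<in> bad_event n e}))
    \<le> real (card relations) * (real (card \<Omega>) / (real W)\<^sup>2)"
proof -
  have "(\<Sum>\<omega>\<in>\<Omega>. real (card {e \<in> relations. \<omega> \<in> bad_event n e}))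
    = (\<Sum>\<omega>\<in>\<Omega>. \<Sum>e\<in>relations. of_bool (\<omega> \<in> bad_event n e))"
    by (intro sum.cong refl) (simp add: finite_relations Int_def)
  also have "\<dots> = (\<Sum>e\<in>relations. \<Sum>\<omega>\<in>\<Omega>. of_bool (\<omega> \<in> bad_event n e))" by (rule sum.swap)
  also have "\<dots> \<le> (\<Sum>e\<in>relations. real (card \<Omega>) / (real W)\<^sup>2)"
  proof (rule sum_mono)
    fix e assume e: "e \<in> relations"
    have "\<Omega> \<inter> {\<omega>. \<omega> \<in> bad_event n e} = bad_event n e" unfolding bad_event_def by auto
    then have "(\<Sum>\<omega>\<in>\<Omega>. of_bool (\<omega> \<in> bad_event n e)) = real (card (bad_event n e))"
      by (simp add: finite_\<Omega>)
    then show "(\<Sum>\<omega>\<in>\<Omega>. of_bool (\<omega> \<in> bad_event n e)) \<le> real (card \<Omega>) / (real W)\<^sup>2"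
      using card_bad_event[OF e, of n] by simp
  qed
  finally show ?thesis by simp
qed

section \<open>The probability that an integer stays uncovered\<close>

definition \<delta> :: real where
  "\<delta> = 4 / \<mu> + 4 * real r / (real W * real m)
     + 4 * (real h)\<^sup>2 * real (card A + 1 + 2 * h * m) ^ (2 * h - 1) * real r / (real W)\<^sup>2"

text \<open>If \<open>n\<close> is uncovered, the bad relations are at least as many as the hits. So
  either they number at least \<open>\<mu> / 2\<close>, which Markov's inequality bounds by the last
  term of \<delta>, or the hits deviate from \<mu> by at least \<open>\<mu> / 2\<close>, which
  Chebyshev's inequality bounds by the first two.\<close>

lemma card_uncovered:
  assumes n: "n \<in> {2 * h * W<..r}"
  shows "real (card {\<omega> \<in> \<Omega>. n \<notin> ksums (2 * h) (A \<union> good \<omega>)}) \<le> \<delta> * real (card \<Omega>)"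
proof -
  define N where "N = real (card \<Omega>)"
  let ?Y = "\<lambda>\<omega>. real (card (hits n \<omega>))"
  let ?B = "\<lambda>\<omega>. real (card {e \<in> relations. \<omega> \<in> bad_event n e})"
  have pt: "of_bool (n \<notin> ksums (2 * h) (A \<union> good \<omega>)) \<le> 4 / \<mu>\<^sup>2 * (?Y \<omega> - \<mu>)\<^sup>2 + 2 / \<mu> * ?B \<omega>"
    if \<omega>: "\<omega> \<in> \<Omega>" for \<omega>
  proof (cases "n \<in> ksums (2 * h) (A \<union> good \<omega>)")
    case True then show ?thesis using \<mu>_pos by simp
  next
    case False
    then have YB: "?Y \<omega> \<le> ?B \<omega>" using card_hits_le_bad[OF \<omega>] by simp
    have "1 \<le> 4 / \<mu>\<^sup>2 * (?Y \<omega> - \<mu>)\<^sup>2 + 2 / \<mu> * ?B \<omega>"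
    proof (cases "?B \<omega> \<ge> \<mu> / 2")
      case True
      then have "1 \<le> 2 / \<mu> * ?B \<omega>" using \<mu>_pos by (simp add: field_simps)
      moreover have "0 \<le> 4 / \<mu>\<^sup>2 * (?Y \<omega> - \<mu>)\<^sup>2" by simp
      ultimately show ?thesis by linarith
    next
      case False
      then have "\<mu> / 2 \<le> \<mu> - ?Y \<omega>" using YB by linarith
      then have "(\<mu> / 2)\<^sup>2 \<le> (?Y \<omega> - \<mu>)\<^sup>2"
        using \<mu>_pos power_mono[of "\<mu> / 2" "\<mu> - ?Y \<omega>" 2] by (simp add: power2_commute)
      then have "1 \<le> 4 / \<mu>\<^sup>2 * (?Y \<omega> - \<mu>)\<^sup>2" using \<mu>_pos by (simp add: field_simps power2_eq_square)
      moreover have "0 \<le> 2 / \<mu> * ?B \<omega>" using \<mu>_pos by simp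
      ultimately show ?thesis by linarith
    qed
    then show ?thesis using False by simp
  qed
  have "real (card {\<omega> \<in> \<Omega>. n \<notin> ksums (2 * h) (A \<union> good \<omega>)})
    = (\<Sum>\<omega>\<in>\<Omega>. of_bool (n \<notin> ksums (2 * h) (A \<union> good \<omega>)))"
    by (simp add: finite_\<Omega> Int_def)
  also have "\<dots> \<le> (\<Sum>\<omega>\<in>\<Omega>. 4 / \<mu>\<^sup>2 * (?Y \<omega> - \<mu>)\<^sup>2 + 2 / \<mu> * ?B \<omega>)" by (rule sum_mono[OF pt])
  also have "\<dots> = 4 / \<mu>\<^sup>2 * (\<Sum>\<omega>\<in>\<Omega>. (?Y \<omega> - \<mu>)\<^sup>2) + 2 / \<mu> * (\<Sum>\<omega>\<in>\<Omega>. ?B \<omega>)"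
    by (simp only: sum.distrib sum_distrib_left)
  also have "\<dots> \<le> 4 / \<mu>\<^sup>2 * (N * (\<mu> + real m ^ (4 * h - 1) / (real r * real W)))
      + 2 / \<mu> * (real (card relations) * (N / (real W)\<^sup>2))"
    unfolding N_def using sum_deviation[OF n] sum_card_bad[of n] \<mu>_pos
    by (intro add_mono mult_left_mono) auto
  also have "\<dots> \<le> 4 / \<mu>\<^sup>2 * (N * (\<mu> + real m ^ (4 * h - 1) / (real r * real W)))
      + 2 / \<mu> * ((real m ^ (2 * h) * (2 * (real h)\<^sup>2 * real (card A + 1 + 2 * h * m) ^ (2 * h - 1))) * (N / (real W)\<^sup>2))"
  proof -
    have "real (card relations) \<le> real m ^ (2 * h) * (2 * (real h)\<^sup>2 * real (card A + 1 + 2 * h * m) ^ (2 * h - 1))"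
      using of_nat_mono[OF card_relations, where 'a = real] by (simp only: of_nat_mult of_nat_power of_nat_numeral)
    then show ?thesis using \<mu>_pos unfolding N_def
      by (intro add_left_mono mult_left_mono mult_right_mono) auto
  qed
  also have "\<dots> = \<delta> * N"
  proof -
    have m: "real m > 0" and r: "real r > 0" and W: "real W > 0" using m_pos r_pos W_pos by auto
    have 1: "real m ^ (4 * h - 1) / (real r * real W) = \<mu>\<^sup>2 * (real r / (real W * real m))"
    proof -
      have "real m ^ (4 * h - 1) * real m = real m ^ (2 * h) * real m ^ (2 * h)"
        using h_pos by (simp flip: power_add power_Suc2)
      then show ?thesis using m r W unfolding \<mu>_def by (simp add: field_simps power2_eq_square)
    qed
    have 2: "real m ^ (2 * h) = \<mu> * real r" using r unfolding \<mu>_def by simp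
    have *: "4 / \<mu>\<^sup>2 * (N * (\<mu> + \<mu>\<^sup>2 * a)) + 2 / \<mu> * (\<mu> * b * c * (N / d)) = (4 / \<mu> + 4 * a + 2 * c * b / d) * N"
      for a b c d using \<mu>_pos by (simp add: distrib_left distrib_right power2_eq_square)
    have "4 / \<mu>\<^sup>2 * (N * (\<mu> + \<mu>\<^sup>2 * (real r / (real W * real m))))
        + 2 / \<mu> * (\<mu> * real r * (2 * (real h)\<^sup>2 * k) * (N / (real W)\<^sup>2))
      = (4 / \<mu> + 4 * real r / (real W * real m) + 4 * (real h)\<^sup>2 * k * real r / (real W)\<^sup>2) * N" for k
      unfolding * by (simp add: mult.assoc)
    then show ?thesis unfolding 1 2 \<delta>_def .
  qed
  finally show ?thesis unfolding N_def .
qed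

text \<open>Count the pairs of a family and an integer of \<open>U\<close> that it leaves uncovered,
  in both orders. As \<open>U\<close> is arbitrary, it can later be whatever earlier families have
  missed.\<close>

lemma exists_good_family:
  assumes U: "U \<subseteq> {2 * h * W<..r}"
  shows "\<exists>\<omega>\<in>\<Omega>. real (card {n \<in> U. n \<notin> ksums (2 * h) (A \<union> good \<omega>)}) \<le> \<delta> * real (card U)"
proof (rule ccontr)
  assume "\<not> ?thesis"
  then have *: "\<delta> * real (card U) < real (card {n \<in> U. n \<notin> ksums (2 * h) (A \<union> good \<omega>)})" if "\<omega> \<in> \<Omega>" for \<omega>
    using that by (metis not_le)
  have finU: "finite U" using U finite_subset by blast
  have "real (card \<Omega>) * (\<delta> * real (card U)) = (\<Sum>\<omega>\<in>\<Omega>. \<delta> * real (card U))" by simp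
  also have "\<dots> < (\<Sum>\<omega>\<in>\<Omega>. real (card {n \<in> U. n \<notin> ksums (2 * h) (A \<union> good \<omega>)}))"
    using * card_\<Omega>_pos finite_\<Omega> by (intro sum_strict_mono) auto
  also have "\<dots> = (\<Sum>\<omega>\<in>\<Omega>. \<Sum>n\<in>U. of_bool (n \<notin> ksums (2 * h) (A \<union> good \<omega>)))"
    by (intro sum.cong refl) (simp add: finU Int_def)
  also have "\<dots> = (\<Sum>n\<in>U. \<Sum>\<omega>\<in>\<Omega>. of_bool (n \<notin> ksums (2 * h) (A \<union> good \<omega>)))" by (rule sum.swap)
  also have "\<dots> = (\<Sum>n\<in>U. real (card {\<omega> \<in> \<Omega>. n \<notin> ksums (2 * h) (A \<union> good \<omega>)}))"
    by (intro sum.cong refl) (simp add: finite_\<Omega> Int_def)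
  also have "\<dots> \<le> (\<Sum>n\<in>U. \<delta> * real (card \<Omega>))"
    using U card_uncovered by (intro sum_mono) auto
  finally show False by (simp add: mult.left_commute mult.commute)
qed

section \<open>Properties of the retained elements\<close>

lemma good_subset: "good \<omega> \<subseteq> \<omega> ` J"
  unfolding good_def by auto

lemma finite_good: "finite (good \<omega>)"
  by (rule finite_subset[OF good_subset]) (simp add: finite_J)

lemma card_good: "card (good \<omega>) \<le> 2 * h * m"
proof -
  have "card (good \<omega>) \<le> card (\<omega> ` J)" by (rule card_mono) (auto simp: finite_J good_subset)
  also have "\<dots> \<le> card J" by (rule card_image_le[OF finite_J])
  finally show ?thesis by (simp add: J_def card_cartesian_product)
qed

lemma good_pos:
  assumes "\<omega> \<in> \<Omega>"
  shows "good \<omega> \<subseteq> {1..}"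
proof -
  have "V i \<subseteq> {1..}" for i unfolding V_def by auto
  then show ?thesis using \<Omega>_in_V[OF assms] unfolding good_def by blast
qed

text \<open>Retained values other than \<open>v\<close> come from positions other than
  \<open>i\<close>, so what remains after removing \<open>v\<close> lies in the set against which
  \<open>v\<close> was tested; \<open>forbidden\<close> is monotone.\<close>

lemma strong_B_good:
  assumes "strong_B h A"
  shows "strong_B h (A \<union> good \<omega>)"
proof (rule strong_B_extend[OF assms])
  fix v assume "v \<in> good \<omega>"
  then obtain i where i: "i \<in> J" "v = \<omega> i" "v \<notin> forbidden h (A \<union> \<omega> ` (J - {i}))"
    unfolding good_def by blast
  have "A \<union> good \<omega> - {v} \<subseteq> A \<union> \<omega> ` (J - {i})" using good_subset[of \<omega>] i(2) by blast
  then show "v \<notin> forbidden h (A \<union> good \<omega> - {v})" using forbidden_mono i(3) by blast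
qed

end

section \<open>Covering one range of integers\<close>

text \<open>The quotient \<open>r / W\<close> for \<open>W = width h k\<close> and
  \<open>r = 2 * h * width h (Suc k)\<close>, which is the same at every level.\<close>

definition ratio :: "nat \<Rightarrow> real" where "ratio h = 2 * real h * 2 ^ (4 * h - 1)"

text \<open>The constant for which \<delta> is at most \<open>loss h / 2 ^ k\<close>; the factor
  \<open>20 * (real h)\<^sup>2\<close> bounds the number of symbols divided by
  \<open>4 ^ k\<close>.\<close>

definition loss :: "nat \<Rightarrow> real" where
  "loss h = 8 * ratio h + 4 * (real h)\<^sup>2 * (20 * (real h)\<^sup>2) ^ (2 * h - 1) * ratio h"

text \<open>At level \<open>k\<close>, with \<open>x = 2\<^sup>k\<close>, every block gets \<open>m = x\<^sup>2\<close> elements and the integers have order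
  \<open>W = x\<^bsup>4h-1\<^esup>\<close>. Then the expected number of representations, of order \<open>m\<^bsup>2h\<^esup> / W = x\<close>, is large, while the
  proportion of bad elements, of order \<open>m\<^bsup>2h-1\<^esup> / W = 1 / x\<close>, is small.\<close>

definition width :: "nat \<Rightarrow> nat \<Rightarrow> nat" where "width h k = (2 ^ k) ^ (4 * h - 1)"

text \<open>Consecutive targets abut, so from any level on they cover all large integers.\<close>

definition target :: "nat \<Rightarrow> nat \<Rightarrow> nat set" where
  "target h k = {2 * h * width h k<..2 * h * width h (Suc k)}"

lemma width_Suc: "width h (Suc k) = 2 ^ (4 * h - 1) * width h k"
  unfolding width_def by (simp add: power_mult_distrib)

lemma real_target_bound: "real (2 * h * width h (Suc k)) = ratio h * real (width h k)"
  unfolding ratio_def width_Suc by simp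

lemma \<delta>_le:
  assumes h: "h \<ge> 1" and A: "finite A" "card A \<le> 16 * h\<^sup>2 * 4 ^ k"
  shows "random_family.\<delta> h (4 ^ k) (width h k) (2 * h * width h (Suc k)) A \<le> loss h / 2 ^ k"
proof -
  have W1: "width h k \<ge> 1" unfolding width_def by simp
  have "width h k \<le> 2 * h * width h (Suc k)" using h unfolding width_Suc by simp
  then interpret random_family h "4 ^ k" "width h k" "2 * h * width h (Suc k)" A
    using h A W1 by unfold_locales auto
  define x where "x = (2::real) ^ k"
  define y where "y = x ^ (4 * h - 1)"
  have x1: "x \<ge> 1" unfolding x_def by simp
  then have y0: "y > 0" unfolding y_def by simp
  have ratio0: "ratio h > 0" using h unfolding ratio_def by simp
  have m: "real (4 ^ k) = x\<^sup>2" unfolding x_def by (simp flip: power_mult_distrib add: power2_eq_square)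
  have W: "real (width h k) = y" unfolding width_def x_def y_def by simp
  have r: "real (2 * h * width h (Suc k)) = ratio h * y" unfolding real_target_bound W ..
  have "(x\<^sup>2) ^ (2 * h) = x * y"
    using h unfolding y_def by (simp flip: power_mult power_Suc)
  then have \<mu>: "\<mu> = x / ratio h"
    unfolding \<mu>_def r m using y0 by simp
  have t1: "4 / \<mu> = 4 * ratio h / x" unfolding \<mu> by simp
  have "4 * (ratio h * y) / (y * x\<^sup>2) = 4 * ratio h / x\<^sup>2" using y0 by simp
  also have "\<dots> \<le> 4 * ratio h / x" using x1 ratio0 by (intro divide_left_mono) (auto simp: power2_eq_square)
  finally have t2: "4 * (ratio h * y) / (y * x\<^sup>2) \<le> 4 * ratio h / x" .
  \<comment> \<open>The contributions of \<open>A\<close>, of the symbol for 0 and of the random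
    positions give 16 + 1 + 2 = 19, rounded up to 20.\<close>
  have "real (card A + 1 + 2 * h * 4 ^ k) \<le> 16 * (real h)\<^sup>2 * x\<^sup>2 + 1 + 2 * real h * x\<^sup>2"
    using of_nat_mono[OF A(2), where 'a = real] m by simp
  also have "\<dots> \<le> 16 * (real h)\<^sup>2 * x\<^sup>2 + (real h)\<^sup>2 * x\<^sup>2 + 2 * (real h)\<^sup>2 * x\<^sup>2"
  proof -
    have "real h \<le> (real h)\<^sup>2" using h by (simp add: power2_eq_square)
    then have "real h * x\<^sup>2 \<le> (real h)\<^sup>2 * x\<^sup>2" by (rule mult_right_mono) simp
    moreover have "1 * 1 \<le> (real h)\<^sup>2 * x\<^sup>2" using h x1 by (intro mult_mono) auto
    ultimately show ?thesis by linarith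
  qed
  also have "\<dots> \<le> 20 * (real h)\<^sup>2 * x\<^sup>2" by simp
  finally have "real (card A + 1 + 2 * h * 4 ^ k) ^ (2 * h - 1) \<le> (20 * (real h)\<^sup>2 * x\<^sup>2) ^ (2 * h - 1)"
    by (rule power_mono) simp
  also have "\<dots> = (20 * (real h)\<^sup>2) ^ (2 * h - 1) * (y / x)"
  proof -
    have "4 * h - 1 = Suc (2 * (2 * h - 1))" using h by simp
    then have "(x\<^sup>2) ^ (2 * h - 1) * x = y" by (simp only: y_def power_Suc2 power_mult)
    then have "(x\<^sup>2) ^ (2 * h - 1) = y / x" using x1 by (simp add: field_simps)
    then show ?thesis by (simp add: power_mult_distrib)
  qed
  finally have K: "real (card A + 1 + 2 * h * 4 ^ k) ^ (2 * h - 1) \<le> (20 * (real h)\<^sup>2) ^ (2 * h - 1) * (y / x)" .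
  have "4 * (real h)\<^sup>2 * real (card A + 1 + 2 * h * 4 ^ k) ^ (2 * h - 1) * (ratio h * y) / y\<^sup>2
    \<le> 4 * (real h)\<^sup>2 * ((20 * (real h)\<^sup>2) ^ (2 * h - 1) * (y / x)) * (ratio h * y) / y\<^sup>2"
    using K y0 ratio0 by (intro divide_right_mono mult_right_mono mult_left_mono) auto
  also have "\<dots> = 4 * (real h)\<^sup>2 * (20 * (real h)\<^sup>2) ^ (2 * h - 1) * ratio h / x"
    using y0 by (simp add: power2_eq_square)
  finally have t3: "4 * (real h)\<^sup>2 * real (card A + 1 + 2 * h * 4 ^ k) ^ (2 * h - 1) * (ratio h * y) / y\<^sup>2
    \<le> 4 * (real h)\<^sup>2 * (20 * (real h)\<^sup>2) ^ (2 * h - 1) * ratio h / x" .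
  have "\<delta> \<le> 4 * ratio h / x + 4 * ratio h / x + 4 * (real h)\<^sup>2 * (20 * (real h)\<^sup>2) ^ (2 * h - 1) * ratio h / x"
    unfolding \<delta>_def r W m t1 using t2 t3 by linarith
  also have "\<dots> = loss h / x" unfolding loss_def by (simp add: add_divide_distrib)
  finally show ?thesis unfolding x_def .
qed

section \<open>Covering a target by repeated reduction\<close>

definition admissible :: "nat \<Rightarrow> nat set \<Rightarrow> bool" where
  "admissible h A \<longleftrightarrow> finite A \<and> A \<subseteq> {1..} \<and> strong_B h A"

lemma reduce_uncovered:
  assumes h: "h \<ge> 1" and A: "admissible h A" "card A \<le> 16 * h\<^sup>2 * 4 ^ k" and U: "U \<subseteq> target h k"
  shows "\<exists>A'. A \<subseteq> A' \<and> admissible h A' \<and> card A' \<le> card A + 2 * h * 4 ^ k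
    \<and> real (card {n \<in> U. n \<notin> ksums (2 * h) A'}) \<le> loss h / 2 ^ k * real (card U)"
proof -
  have finA: "finite A" using A(1) unfolding admissible_def by blast
  have W1: "width h k \<ge> 1" unfolding width_def by simp
  have "width h k \<le> 2 * h * width h (Suc k)" using h unfolding width_Suc by simp
  then interpret random_family h "4 ^ k" "width h k" "2 * h * width h (Suc k)" A
    using h finA W1 by unfold_locales auto
  obtain \<omega> where \<omega>: "\<omega> \<in> \<Omega>" "real (card {n \<in> U. n \<notin> ksums (2 * h) (A \<union> good \<omega>)}) \<le> \<delta> * real (card U)"
    using exists_good_family[OF U[unfolded target_def]] by blast
  note \<omega>(2)
  also have "\<delta> * real (card U) \<le> loss h / 2 ^ k * real (card U)"
    by (rule mult_right_mono[OF \<delta>_le[OF h finA A(2)]]) simp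
  finally have "real (card {n \<in> U. n \<notin> ksums (2 * h) (A \<union> good \<omega>)}) \<le> loss h / 2 ^ k * real (card U)" .
  moreover have "admissible h (A \<union> good \<omega>)"
    using A(1) finite_good good_pos[OF \<omega>(1)] strong_B_good unfolding admissible_def by blast
  moreover have "card (A \<union> good \<omega>) \<le> card A + 2 * h * 4 ^ k"
    using card_Un_le[of A "good \<omega>"] card_good[of \<omega>] by linarith
  ultimately show ?thesis by blast
qed

text \<open>Each round treats only the integers still uncovered, and enlarging the set never
  uncovers any. At most \<open>4 * h\<close> rounds add at most \<open>8 * h\<^sup>2 * 4 ^ k\<close>
  elements, which keeps the size within the bound required for a reduction.\<close>

lemma iterate_reduction:
  assumes h: "h \<ge> 1" and A: "admissible h A" "card A \<le> 8 * h\<^sup>2 * 4 ^ k"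
  shows "i \<le> 4 * h \<Longrightarrow> \<exists>A'. A \<subseteq> A' \<and> admissible h A' \<and> card A' \<le> card A + i * (2 * h * 4 ^ k)
    \<and> real (card {n \<in> target h k. n \<notin> ksums (2 * h) A'}) \<le> (loss h / 2 ^ k) ^ i * real (card (target h k))"
proof (induction i)
  case 0
  have "card {n \<in> target h k. n \<notin> ksums (2 * h) A} \<le> card (target h k)"
    by (rule card_mono) (auto simp: target_def)
  then show ?case using A by (intro exI[of _ A]) auto
next
  case (Suc i)
  then obtain B where B: "A \<subseteq> B" "admissible h B" "card B \<le> card A + i * (2 * h * 4 ^ k)"
    "real (card {n \<in> target h k. n \<notin> ksums (2 * h) B}) \<le> (loss h / 2 ^ k) ^ i * real (card (target h k))"
    by auto
  let ?U = "{n \<in> target h k. n \<notin> ksums (2 * h) B}"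
  have "i * (2 * h * 4 ^ k) \<le> 4 * h * (2 * h * 4 ^ k)" using Suc.prems by (intro mult_right_mono) auto
  also have "\<dots> = 8 * h\<^sup>2 * 4 ^ k" by (simp add: power2_eq_square)
  finally have *: "i * (2 * h * 4 ^ k) \<le> 8 * h\<^sup>2 * 4 ^ k" .
  have "card B \<le> 16 * h\<^sup>2 * 4 ^ k"
    using B(3) A(2) * by linarith
  then obtain A' where A': "B \<subseteq> A'" "admissible h A'" "card A' \<le> card B + 2 * h * 4 ^ k"
    "real (card {n \<in> ?U. n \<notin> ksums (2 * h) A'}) \<le> loss h / 2 ^ k * real (card ?U)"
    using reduce_uncovered[OF h B(2), of k ?U] by blast
  have C0: "loss h / 2 ^ k \<ge> 0" unfolding loss_def ratio_def by simp
  have "{n \<in> ?U. n \<notin> ksums (2 * h) A'} = {n \<in> target h k. n \<notin> ksums (2 * h) A'}"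
    using ksums_mono[OF A'(1)] by auto
  then have "real (card {n \<in> target h k. n \<notin> ksums (2 * h) A'}) \<le> loss h / 2 ^ k * real (card ?U)"
    using A'(4) by simp
  also have "\<dots> \<le> loss h / 2 ^ k * ((loss h / 2 ^ k) ^ i * real (card (target h k)))"
    by (rule mult_left_mono[OF B(4) C0])
  finally have "real (card {n \<in> target h k. n \<notin> ksums (2 * h) A'})
    \<le> (loss h / 2 ^ k) ^ Suc i * real (card (target h k))" by simp
  moreover have "card A' \<le> card A + Suc i * (2 * h * 4 ^ k)" using A'(3) B(3) by simp
  ultimately show ?case using A'(1,2) B(1) by blast
qed

text \<open>With \<open>x = 2 ^ k\<close>, the target has at most
  \<open>ratio h * x ^ (4 * h - 1)\<close> elements, so \<open>4 * h\<close> factors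
  \<open>loss h / x\<close> leave fewer than one. The final size, at most
  \<open>16 * h\<^sup>2 * 4 ^ k\<close>, meets the size hypothesis of the next level.\<close>

lemma cover_target:
  assumes h: "h \<ge> 1" and A: "admissible h A" "card A \<le> 8 * h\<^sup>2 * 4 ^ k"
    and k: "loss h ^ (4 * h) * ratio h < 2 ^ k"
  shows "\<exists>A'. A \<subseteq> A' \<and> admissible h A' \<and> card A' \<le> 8 * h\<^sup>2 * 4 ^ Suc k \<and> target h k \<subseteq> ksums (2 * h) A'"
proof -
  obtain A' where A': "A \<subseteq> A'" "admissible h A'" "card A' \<le> card A + 4 * h * (2 * h * 4 ^ k)"
    "real (card {n \<in> target h k. n \<notin> ksums (2 * h) A'}) \<le> (loss h / 2 ^ k) ^ (4 * h) * real (card (target h k))"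
    using iterate_reduction[OF h A, of "4 * h"] by auto
  define x where "x = (2::real) ^ k"
  have x0: "x > 0" unfolding x_def by simp
  have C0: "loss h \<ge> 0" unfolding loss_def ratio_def by simp
  have "real (card (target h k)) \<le> real (2 * h * width h (Suc k))"
    unfolding target_def by (simp only: of_nat_le_iff card_greaterThanAtMost diff_le_self)
  also have "\<dots> = ratio h * x ^ (4 * h - 1)" unfolding real_target_bound by (simp add: width_def x_def)
  finally have "(loss h / x) ^ (4 * h) * real (card (target h k)) \<le> (loss h / x) ^ (4 * h) * (ratio h * x ^ (4 * h - 1))"
    using C0 x0 by (intro mult_left_mono) auto
  also have "\<dots> = loss h ^ (4 * h) * ratio h / x"
  proof -
    have "x ^ (4 * h) = x * x ^ (4 * h - 1)" using h by (simp flip: power_Suc)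
    then show ?thesis using x0 by (simp add: power_divide)
  qed
  also have "\<dots> < 1" using k x0 unfolding x_def by simp
  finally have "card {n \<in> target h k. n \<notin> ksums (2 * h) A'} = 0" using A'(4) unfolding x_def by linarith
  moreover have "finite {n \<in> target h k. n \<notin> ksums (2 * h) A'}" unfolding target_def by simp
  ultimately have "target h k \<subseteq> ksums (2 * h) A'" by auto
  moreover have "card A' \<le> 8 * h\<^sup>2 * 4 ^ Suc k" using A'(3) A(2) by (simp add: power2_eq_square)
  ultimately show ?thesis using A'(1,2) by blast
qed

section \<open>The union over all levels\<close>

theorem theorem1:
  fixes h :: nat
  assumes "h \<ge> 2"
  shows "\<exists>A :: nat set. A \<subseteq> {1..} \<and> asymptotic_basis (2 * h) A \<and> B_set h 1 A"
proof -
  have h: "h \<ge> 1" using assms by simp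
  obtain k0 where k0: "loss h ^ (4 * h) * ratio h < 2 ^ k0"
    using real_arch_pow[of 2] by auto
  define Q where "Q = (\<lambda>k A. admissible h A \<and> card A \<le> 8 * h\<^sup>2 * 4 ^ (k0 + k))"
  \<comment> \<open>The construction starts from the empty set at level \<open>k0\<close>, beyond
    which the size condition of \<open>cover_target\<close> holds throughout.\<close>
  have "\<exists>S. \<forall>k. Q k (S k) \<and> (S k \<subseteq> S (Suc k) \<and> target h (k0 + k) \<subseteq> ksums (2 * h) (S (Suc k)))"
  proof (rule dependent_nat_choice)
    show "\<exists>A. Q 0 A" by (rule exI[of _ "{}"]) (simp add: Q_def admissible_def strong_B_empty)
    fix A k assume "Q k A"
    then have "admissible h A" "card A \<le> 8 * h\<^sup>2 * 4 ^ (k0 + k)" unfolding Q_def by auto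
    moreover have "loss h ^ (4 * h) * ratio h < 2 ^ (k0 + k)"
      by (rule less_le_trans[OF k0]) (auto intro: power_increasing)
    ultimately show "\<exists>B. Q (Suc k) B \<and> (A \<subseteq> B \<and> target h (k0 + k) \<subseteq> ksums (2 * h) B)"
      using cover_target[OF h, of A "k0 + k"] unfolding Q_def add_Suc_right by blast
  qed
  then obtain S where S: "\<And>k. Q k (S k)" "\<And>k. S k \<subseteq> S (Suc k)"
    "\<And>k. target h (k0 + k) \<subseteq> ksums (2 * h) (S (Suc k))" by blast
  let ?A = "\<Union>k. S k"
  have "R (2 * h) ?A n > 0" if n: "n > 2 * h * width h k0" for n
  proof (rule ksums_imp_R_pos)
    have "\<exists>j. n \<le> 2 * h * width h (k0 + j)"
    proof
      have "n \<le> 2 ^ (k0 + n)" by (metis le_add2 le_trans less_imp_le less_exp)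
      also have "\<dots> \<le> (2 ^ (k0 + n)) ^ (4 * h - 1)" using h by (intro self_le_power) auto
      also have "\<dots> \<le> 2 * h * width h (k0 + n)" using h unfolding width_def by simp
      finally show "n \<le> 2 * h * width h (k0 + n)" .
    qed
    \<comment> \<open>The least such \<open>j\<close> is nonzero because \<open>n\<close> exceeds
      the lower end of the first target, so \<open>n\<close> lies in the target just below level
      \<open>k0 + j\<close>.\<close>
    then obtain j where j: "n \<le> 2 * h * width h (k0 + j)"
      and min: "\<And>i. i < j \<Longrightarrow> \<not> n \<le> 2 * h * width h (k0 + i)"
      using exists_least_iff[of "\<lambda>j. n \<le> 2 * h * width h (k0 + j)"] by blast
    then obtain i where i: "j = Suc i" using n by (cases j) auto
    have "n \<in> target h (k0 + i)" using j min[of i] unfolding i target_def by simp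
    then show "n \<in> ksums (2 * h) ?A"
      using S(3)[of i] ksums_mono[of "S (Suc i)" ?A "2 * h"] by blast
  qed
  then have "asymptotic_basis (2 * h) ?A" unfolding asymptotic_basis_def by blast
  moreover have "?A \<subseteq> {1..}" using S(1) unfolding Q_def admissible_def by blast
  moreover have "B_set h 1 ?A"
    using S(1,2) unfolding Q_def admissible_def by (intro strong_B_imp_B_set strong_B_Union_chain) auto
  ultimately show ?thesis by blast
qed

end
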